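(* Let $G=(V,E)$ be the graph with $$V=\{a,b,x,c,d\},\qquad E=\{ab,bc,bd,xc,xd\},$$ let the target be $x$, and take initial weights $\omega=(2,5,1,0,0)$ in the order $(a,b,x,c,d)$. The maximum of $(A_\sigma\omega)_x$ over all strategies $\sigma$ is $65/32$, whereas the maximum of $(A_\sigma\omega)_x$ over all repetition-free strategies $\sigma$ is $2$. Thus every optimal strategy (one attaining $65/32$) averages some nontrivial connected set at least twice. The minimum length of an optimal strategy is $4$.
   Context: A nonempty set $S\subseteq V$ is called connected if the induced subgraph $G[S]$ is connected; it is nontrivial if $|S|\ge2$. For nonempty connected $S$, the averaging operator $A_S\in\mathbb R^{V\times V}$ is defined by $(A_Sz)_v=|S|^{-1}\sum_{u\in S}z_u$ if $v\in S$ and $(A_Sz)_v=z_v$ if $v\notin S$. A strategy is a finite (possibly empty) sequence $\sigma=(S_1,\ldots,S_k)$ of nonempty connected sets, listed in chronological order; its length is $k$ and its operator is $A_\sigma=A_{S_k}\cdots A_{S_1}$ (the identity if $k=0$). A strategy is repetition-free if no nontrivial connected set occurs in it more than once. *)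

theory Defs
  imports "HOL-Analysis.Analysis" "Graph_Theory.Graph_Theory"
begin

text \<open>Simple graphs are represented as in \<open>Graph_Theory\<close>, by symmetric loop-free digraphs
  (locale \<open>pair_graph\<close>).  The name \<open>connected\<close> is qualified below because the topological
  notion of the same name is also in scope; \<open>Digraph_Component.connected\<close> includes
  nonemptiness of the vertex set.\<close>

definition connected_set :: "'v pair_pre_digraph \<Rightarrow> 'v set \<Rightarrow> bool" where
  "connected_set G S \<longleftrightarrow>
     S \<noteq> {} \<and> S \<subseteq> pverts G \<and> Digraph_Component.connected (induce_subgraph (with_proj G) S)"

definition nontrivial :: "'v set \<Rightarrow> bool" where
  "nontrivial S \<longleftrightarrow> card S \<ge> 2"

definition averaging :: "'v::finite set \<Rightarrow> real ^ 'v \<Rightarrow> real ^ 'v" where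
  "averaging S z = (\<chi> v. if v \<in> S then (\<Sum>u\<in>S. z $ u) / real (card S) else z $ v)"

lemma linear_averaging: "linear (averaging S)"
  by (rule linearI)
    (auto simp: averaging_def vec_eq_iff sum.distrib sum_distrib_left add_divide_distrib)

definition strategies :: "'v pair_pre_digraph \<Rightarrow> 'v set list set" where
  "strategies G = {\<sigma>. \<forall>S\<in>set \<sigma>. connected_set G S}"

text \<open>The list is in chronological order, and \<open>fold\<close> applies its head first.\<close>

definition strategy_op :: "'v::finite set list \<Rightarrow> real ^ 'v \<Rightarrow> real ^ 'v" where
  "strategy_op \<sigma> = fold averaging \<sigma>"

definition repetition_free :: "'v pair_pre_digraph \<Rightarrow> 'v set list \<Rightarrow> bool" where
  "repetition_free G \<sigma> \<longleftrightarrow>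
     (\<forall>S. connected_set G S \<and> nontrivial S \<longrightarrow> count_list \<sigma> S \<le> 1)"

text \<open>Maximum and minimum of a possibly infinite set, for which \<open>Max\<close> and \<open>Min\<close> are not
  meaningful.\<close>

definition is_maximum :: "'a::order \<Rightarrow> 'a set \<Rightarrow> bool" where
  "is_maximum m A \<longleftrightarrow> m \<in> A \<and> (\<forall>y\<in>A. y \<le> m)"

definition is_minimum :: "'a::order \<Rightarrow> 'a set \<Rightarrow> bool" where
  "is_minimum m A \<longleftrightarrow> m \<in> A \<and> (\<forall>y\<in>A. m \<le> y)"

definition optimal_strategies ::
    "'v::finite pair_pre_digraph \<Rightarrow> 'v \<Rightarrow> real ^ 'v \<Rightarrow> 'v set list set" where
  "optimal_strategies G t w = {\<sigma> \<in> strategies G.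
     is_maximum (strategy_op \<sigma> w $ t) ((\<lambda>\<tau>. strategy_op \<tau> w $ t) ` strategies G)}"

datatype vertex = Va | Vb | Vx | Vc | Vd

lemma UNIV_vertex: "(UNIV :: vertex set) = {Va, Vb, Vx, Vc, Vd}"
  using vertex.exhaust by blast

instance vertex :: finite
  by standard (simp add: UNIV_vertex)

definition edges :: "vertex rel" where
  "edges = {(Va, Vb), (Vb, Vc), (Vb, Vd), (Vx, Vc), (Vx, Vd)}"

definition graph_G :: "vertex pair_pre_digraph" where
  "graph_G = \<lparr> pverts = {Va, Vb, Vx, Vc, Vd}, parcs = edges \<union> edges\<inverse> \<rparr>"

lemma pair_graph_G: "pair_graph graph_G"
  by unfold_locales (auto simp: graph_G_def edges_def symmetric_def sym_def)

definition omega :: "real ^ vertex" where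
  "omega = (\<chi> v. case v of Va \<Rightarrow> 2 | Vb \<Rightarrow> 5 | Vx \<Rightarrow> 1 | Vc \<Rightarrow> 0 | Vd \<Rightarrow> 0)"

end

theory Submission
  imports Defs
begin

text \<open>
  The matrix of \<open>averaging S\<close> is symmetric, so the value of a strategy \<open>S\<^sub>1, \<dots>, S\<^sub>k\<close> on weights \<open>z\<close>
  is the inner product of \<open>z\<close> with the vector obtained from the unit vector at \<open>x\<close> by averaging
  over \<open>S\<^sub>k, \<dots>, S\<^sub>1\<close>.  Although these vectors are infinitely many, their convex hull is a polytope.
  On nonnegative weights it may be enlarged by the vector with all entries \<open>1/4\<close> and by everything
  that lies below a member coordinatewise; 18 generators then remain (ten up to exchanging
  \<open>c\<close> and \<open>d\<close>).  The predicate \<open>bounded_by M\<close> says that the weights are nonnegative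
  and have inner product at most \<open>M\<close> with all these generators.  It is preserved by averaging over every connected set
  (\<open>bounded_by_averaging\<close>), it bounds the weight of the target, and it holds for the initial
  weights with \<open>M = 65/32\<close>.  The strategy \<open>xc, bc, abxd, xc\<close> attains this value.

  If the first nontrivial set is neither \<open>xc\<close> nor \<open>xd\<close>, then the weights after it satisfy
  \<open>bounded_by 2\<close>, so the value is at most 2.  Suppose that it is \<open>xc\<close>; the other case is its mirror
  image.  The same construction with the averaging over \<open>xc\<close> left out gives a smaller polytope,
  and on the weights after the first step the inner products with its members are at most 2
  (\<open>bounded_avoiding_first\<close>, \<open>bounded_avoiding_averaging\<close>).  Hence a strategy of value above 2
  averages \<open>xc\<close> a second time (\<open>value_gt_2_returns\<close>), and is not repetition-free.  Value 2 is
  attained by averaging once over \<open>bxc\<close>.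

  A strategy of value above 2 with at most three steps would consist of \<open>xc\<close>, a second \<open>xc\<close> and at
  most one further nontrivial set; \<open>averaging_twice_le\<close> excludes this by inspecting that set.
\<close>

section \<open>Connected sets of the graph\<close>

lemma connected_set_has_neighbour:
  assumes S: "connected_set graph_G S" "nontrivial S" and v: "v \<in> S"
  shows "\<exists>u\<in>S. (v, u) \<in> edges \<union> edges\<inverse>"
proof -
  let ?H = "mk_symmetric (induce_subgraph (with_proj graph_G) S)"
  have "S \<noteq> {v}"
    using S(2) by (auto simp: nontrivial_def)
  then obtain u where u: "u \<in> S" "u \<noteq> v"
    using v by blast
  have "v \<rightarrow>\<^sup>*\<^bsub>?H\<^esub> u"
    using S(1) u(1) v
    unfolding connected_set_def Digraph_Component.connected_def strongly_connected_def by simp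
  then have "(v, u) \<in> rtrancl_on S (parcs ?H)"
    by (simp add: reachable_def)
  then have "(v, u) \<in> (parcs ?H)\<^sup>*"
    by (rule rtrancl_on_rtranclI)
  then obtain w where "(v, w) \<in> parcs ?H"
    using u(2) by (metis converse_rtranclE)
  then show ?thesis
    by (auto simp: parcs_mk_symmetric graph_G_def)
qed

text \<open>Sixteen of the 26 vertex sets of size at least two are connected; each of the other ten
  contains a vertex without a neighbour in the set.\<close>

lemma connected_nontrivial_cases:
  assumes "connected_set graph_G S" "nontrivial S"
  shows "S \<in> {{Va, Vb}, {Vb, Vc}, {Vb, Vd}, {Vx, Vc}, {Vx, Vd},
    {Va, Vb, Vc}, {Va, Vb, Vd}, {Vb, Vx, Vc}, {Vb, Vx, Vd}, {Vb, Vc, Vd}, {Vx, Vc, Vd},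
    {Va, Vb, Vx, Vc}, {Va, Vb, Vx, Vd}, {Va, Vb, Vc, Vd}, {Vb, Vx, Vc, Vd},
    {Va, Vb, Vx, Vc, Vd}}" (is "S \<in> ?\<C>")
proof -
  have S_eq: "S = (if Vd \<in> S then {Vd} else {}) \<union> ((if Vc \<in> S then {Vc} else {})
    \<union> ((if Vx \<in> S then {Vx} else {}) \<union> ((if Vb \<in> S then {Vb} else {})
    \<union> (if Va \<in> S then {Va} else {}))))" (is "S = ?U")
  proof (rule set_eqI)
    show "v \<in> S \<longleftrightarrow> v \<in> ?U" for v by (cases v) simp_all
  qed
  have nb: "\<exists>u\<in>S. (v, u) \<in> edges \<union> edges\<inverse>" if "v \<in> S" for v
    using connected_set_has_neighbour[OF assms that] .
  have "Va \<in> S \<Longrightarrow> Vb \<in> S" "Vb \<in> S \<Longrightarrow> Va \<in> S \<or> Vc \<in> S \<or> Vd \<in> S"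
    "Vx \<in> S \<Longrightarrow> Vc \<in> S \<or> Vd \<in> S" "Vc \<in> S \<Longrightarrow> Vb \<in> S \<or> Vx \<in> S"
    "Vd \<in> S \<Longrightarrow> Vb \<in> S \<or> Vx \<in> S"
    using nb[of Va] nb[of Vb] nb[of Vx] nb[of Vc] nb[of Vd] by (auto simp: edges_def)
  moreover have "Va \<in> S \<or> Vb \<in> S \<or> Vx \<in> S \<or> Vc \<in> S \<or> Vd \<in> S"
    using assms(1) unfolding connected_set_def by (metis all_not_in_conv vertex.exhaust)
  ultimately have "?U \<in> ?\<C>"
    by (cases "Va \<in> S"; cases "Vb \<in> S"; cases "Vx \<in> S"; cases "Vc \<in> S"; cases "Vd \<in> S") simp_all
  then show ?thesis
    by (rule ssubst[OF S_eq])
qed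

lemma connected_setI:
  assumes c: "c \<in> S" and path: "\<And>v. v \<in> S \<Longrightarrow> (c, v) \<in> ((edges \<union> edges\<inverse>) \<inter> S \<times> S)\<^sup>*"
  shows "connected_set graph_G S"
proof -
  let ?r = "(edges \<union> edges\<inverse>) \<inter> S \<times> S"
  let ?H = "mk_symmetric (induce_subgraph (with_proj graph_G) S)"
  have parcs: "parcs ?H = ?r"
    by (auto simp: parcs_mk_symmetric graph_G_def)
  have sym: "sym (?r\<^sup>*)"
    by (intro sym_rtrancl) (auto simp: sym_def)
  have "(u, v) \<in> ?r\<^sup>*" if "u \<in> S" "v \<in> S" for u v
    using path[OF that(1)] path[OF that(2)] sym by (meson rtrancl_trans symE)
  moreover have "(u, v) \<in> rtrancl_on S ?r" if "(u, v) \<in> ?r\<^sup>*" "u \<in> S" "v \<in> S" for u v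
    using that by (intro rtrancl_consistent_rtrancl_on) auto
  ultimately show ?thesis
    using c UNIV_vertex parcs
    unfolding connected_set_def Digraph_Component.connected_def strongly_connected_def reachable_def
    by (auto simp: graph_G_def)
qed

lemma connected_sets:
  "connected_set graph_G {Vx, Vc}" "connected_set graph_G {Vb, Vc}"
  "connected_set graph_G {Va, Vb, Vx, Vd}" "connected_set graph_G {Vb, Vx, Vc}"
proof -
  show "connected_set graph_G {Vx, Vc}" "connected_set graph_G {Vb, Vc}"
    "connected_set graph_G {Vb, Vx, Vc}"
    by (rule connected_setI[of Vc]; auto simp: edges_def)+
  show "connected_set graph_G {Va, Vb, Vx, Vd}"
    by (rule connected_setI[of Vb])
      (auto intro: rtrancl_into_rtrancl[of Vb Vd _ Vx] simp: edges_def)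
qed

section \<open>Averaging\<close>

lemma averaging_in: "v \<in> S \<Longrightarrow> averaging S z $ v = (\<Sum>u\<in>S. z $ u) / real (card S)"
  and averaging_notin: "v \<notin> S \<Longrightarrow> averaging S z $ v = z $ v"
  by (simp_all add: averaging_def)

lemma averaging_trivial:
  assumes "S \<noteq> {}" "\<not> nontrivial S"
  shows "averaging S z = z"
proof -
  have "card S = 1"
    using assms by (simp add: nontrivial_def card_gt_0_iff order_antisym Suc_leI not_le less_Suc_eq_le)
  then show ?thesis
    by (auto simp: card_1_singleton_iff averaging_def vec_eq_iff)
qed

lemma strategy_op_Nil [simp]: "strategy_op [] z = z"
  and strategy_op_Cons [simp]: "strategy_op (S # \<sigma>) z = strategy_op \<sigma> (averaging S z)"
  by (simp_all add: strategy_op_def)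

lemma strategy_op_filter_nontrivial:
  assumes "\<sigma> \<in> strategies graph_G"
  shows "strategy_op (filter nontrivial \<sigma>) z = strategy_op \<sigma> z"
  using assms
  by (induction \<sigma> arbitrary: z) (auto simp: strategies_def connected_set_def averaging_trivial)

section \<open>A bound for all strategies\<close>

text \<open>Up to a common denominator, each inequality below from \<open>x \<le> M\<close> on bounds by \<open>M\<close> the inner
  product of the weights with one generator of the polytope; for instance, the last one belongs
  to the vector \<open>(1/8, 5/16, 7/32, 7/32, 1/8)\<close>.  Of two generators that differ by exchanging \<open>c\<close> and
  \<open>d\<close> only one is listed, and \<open>bounded_by\<close> adds the other.\<close>

definition weights_bounded :: "real \<Rightarrow> real \<Rightarrow> real \<Rightarrow> real \<Rightarrow> real \<Rightarrow> real \<Rightarrow> bool" where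
  "weights_bounded M a b x c d \<longleftrightarrow>
     0 \<le> a \<and> 0 \<le> b \<and> 0 \<le> x \<and> 0 \<le> c \<and> 0 \<le> d \<and>
     x \<le> M \<and>
     a + b + x + c + d \<le> 4 * M \<and>
     x + c \<le> 2 * M \<and>
     b + x + c \<le> 3 * M \<and>
     x + 2 * c + d \<le> 4 * M \<and>
     b + x + 3 * c + d \<le> 6 * M \<and>
     a + b + x + 4 * c + d \<le> 8 * M \<and>
     2 * b + x + 2 * c + d \<le> 6 * M \<and>
     2 * a + 5 * b + 2 * x + 5 * c + 2 * d \<le> 16 * M \<and>
     4 * a + 10 * b + 7 * x + 7 * c + 4 * d \<le> 32 * M"

definition bounded_by :: "real \<Rightarrow> real ^ vertex \<Rightarrow> bool" where
  "bounded_by M z \<longleftrightarrow>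
     weights_bounded M (z $ Va) (z $ Vb) (z $ Vx) (z $ Vc) (z $ Vd) \<and>
     weights_bounded M (z $ Va) (z $ Vb) (z $ Vx) (z $ Vd) (z $ Vc)"

text \<open>Each generator averaged over \<open>S\<close> lies coordinatewise below a convex combination of
  generators.  Thus each inequality for the new weights is a nonnegative linear combination of
  inequalities for the old ones.\<close>

lemma bounded_by_averaging:
  assumes "connected_set graph_G S" "nontrivial S" "bounded_by M z"
  shows "bounded_by M (averaging S z)"
  using connected_nontrivial_cases[OF assms(1,2)] assms(3)
  unfolding insert_iff empty_iff
  by (elim disjE;
      simp add: bounded_by_def averaging_in averaging_notin;
      unfold weights_bounded_def; elim conjE; intro conjI; argo)

section \<open>A bound for strategies avoiding one edge at the target\<close>

text \<open>The analogue of the previous bound, with \<open>M = 2\<close>, when averaging over \<open>{x, c}\<close> is excluded.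
  Fewer vectors arise, but \<open>c\<close> and \<open>d\<close> no longer play symmetric roles, and a set of generators
  is listed in full.  In \<open>bounded_avoiding p q\<close> the excluded set is \<open>{x, p}\<close>, and \<open>q\<close> is the other one
  of \<open>c\<close> and \<open>d\<close>.\<close>

definition avoiding_weights_bounded :: "real \<Rightarrow> real \<Rightarrow> real \<Rightarrow> real \<Rightarrow> real \<Rightarrow> bool" where
  "avoiding_weights_bounded a b x c d \<longleftrightarrow>
     0 \<le> a \<and> 0 \<le> b \<and> 0 \<le> x \<and> 0 \<le> c \<and> 0 \<le> d \<and>
     x \<le> 2 \<and>
     a + b + x + c + d \<le> 8 \<and>
     x + d \<le> 4 \<and>
     x + c + d \<le> 6 \<and>
     b + x + c \<le> 6 \<and>
     b + x + d \<le> 6 \<and>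
     b + x + c + 3 * d \<le> 12 \<and>
     a + b + x + c + 4 * d \<le> 16 \<and>
     2 * b + x + 2 * c + d \<le> 12 \<and>
     2 * b + x + c + 2 * d \<le> 12 \<and>
     a + b + 2 * x + 2 * c \<le> 12 \<and>
     a + b + x + 2 * c + d \<le> 12 \<and>
     a + b + 2 * x + 2 * c + 6 * d \<le> 24 \<and>
     2 * a + b + 4 * x + 4 * c + d \<le> 24 \<and>
     3 * b + 2 * x + 4 * c + 3 * d \<le> 24 \<and>
     2 * a + 5 * b + 2 * x + 2 * c + 5 * d \<le> 32 \<and>
     2 * a + 5 * b + 3 * x + 3 * c + 3 * d \<le> 32 \<and>
     3 * a + 3 * b + 4 * x + 8 * c + 6 * d \<le> 48 \<and>
     4 * a + 2 * b + 5 * x + 8 * c + 5 * d \<le> 48 \<and>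
     4 * a + 10 * b + 7 * x + 4 * c + 7 * d \<le> 64"

definition bounded_avoiding :: "vertex \<Rightarrow> vertex \<Rightarrow> real ^ vertex \<Rightarrow> bool" where
  "bounded_avoiding p q z \<longleftrightarrow> avoiding_weights_bounded (z $ Va) (z $ Vb) (z $ Vx) (z $ p) (z $ q)"

lemma bounded_avoiding_averaging:
  assumes "connected_set graph_G S" "nontrivial S" "S \<noteq> {Vx, p}" "bounded_avoiding p q z"
    and pq: "p = Vc \<and> q = Vd \<or> p = Vd \<and> q = Vc"
  shows "bounded_avoiding p q (averaging S z)"
  using pq connected_nontrivial_cases[OF assms(1,2)] assms(3,4)
  unfolding insert_iff empty_iff
  by (elim disjE conjE;
      simp add: bounded_avoiding_def averaging_in averaging_notin;
      unfold avoiding_weights_bounded_def; elim conjE; intro conjI; argo)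


section \<open>Values of strategies\<close>

lemma strategy_value_le:
  assumes "\<sigma> \<in> strategies graph_G" "bounded_by M z"
  shows "strategy_op \<sigma> z $ Vx \<le> M"
  using assms
proof (induction \<sigma> arbitrary: z)
  case Nil
  then show ?case
    by (simp add: bounded_by_def weights_bounded_def)
next
  case (Cons S \<sigma>)
  then have S: "connected_set graph_G S" and \<sigma>: "\<sigma> \<in> strategies graph_G"
    by (auto simp: strategies_def)
  have "bounded_by M (averaging S z)"
    using bounded_by_averaging[OF S _ Cons.prems(2)] averaging_trivial[of S z] Cons.prems(2) S
    by (cases "nontrivial S") (auto simp: connected_set_def)
  then show ?case
    using Cons.IH[OF \<sigma>] by simp
qed

lemma strategy_value_le_avoiding:
  assumes "\<sigma> \<in> strategies graph_G" "{Vx, p} \<notin> set \<sigma>" "bounded_avoiding p q z"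
    and pq: "p = Vc \<and> q = Vd \<or> p = Vd \<and> q = Vc"
  shows "strategy_op \<sigma> z $ Vx \<le> 2"
  using assms(1-3)
proof (induction \<sigma> arbitrary: z)
  case Nil
  then show ?case
    by (simp add: bounded_avoiding_def avoiding_weights_bounded_def)
next
  case (Cons S \<sigma>)
  then have S: "connected_set graph_G S" "S \<noteq> {Vx, p}"
    and \<sigma>: "\<sigma> \<in> strategies graph_G" "{Vx, p} \<notin> set \<sigma>"
    by (auto simp: strategies_def)
  have "bounded_avoiding p q (averaging S z)"
    using bounded_avoiding_averaging[OF S(1) _ S(2) Cons.prems(3) pq]
      averaging_trivial[of S z] Cons.prems(3) S(1)
    by (cases "nontrivial S") (auto simp: connected_set_def)
  then show ?case
    using Cons.IH[OF \<sigma>] by simp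
qed

section \<open>Strategies on the given weights\<close>

lemma omega_simps [simp]:
  "omega $ Va = 2" "omega $ Vb = 5" "omega $ Vx = 1" "omega $ Vc = 0" "omega $ Vd = 0"
  by (simp_all add: omega_def)

lemma bounded_by_omega: "bounded_by (65 / 32) omega"
  by (simp add: bounded_by_def weights_bounded_def)

lemma bounded_by_first:
  assumes "connected_set graph_G S" "nontrivial S" "S \<noteq> {Vx, Vc}" "S \<noteq> {Vx, Vd}"
  shows "bounded_by 2 (averaging S omega)"
  using connected_nontrivial_cases[OF assms(1,2)] assms(3,4)
  unfolding insert_iff empty_iff
  by (elim disjE; simp add: bounded_by_def weights_bounded_def averaging_in averaging_notin)

lemma bounded_avoiding_first:
  assumes "p = Vc \<and> q = Vd \<or> p = Vd \<and> q = Vc"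
  shows "bounded_avoiding p q (averaging {Vx, p} omega)"
  using assms
  by (elim disjE conjE; simp add: bounded_avoiding_def avoiding_weights_bounded_def averaging_in averaging_notin)

text \<open>Sets that are not nontrivial are singletons, which leave the weights unchanged and are
  removed by the filter.\<close>

lemma value_gt_2_returns:
  assumes \<sigma>: "\<sigma> \<in> strategies graph_G" and gt: "strategy_op \<sigma> omega $ Vx > 2"
  obtains p \<tau> where "p = Vc \<or> p = Vd" "filter nontrivial \<sigma> = {Vx, p} # \<tau>" "{Vx, p} \<in> set \<tau>"
proof (cases "filter nontrivial \<sigma>")
  case Nil
  then have "strategy_op \<sigma> omega = omega"
    using strategy_op_filter_nontrivial[OF \<sigma>, of omega] by simp
  with gt show ?thesis
    by simp
next
  case (Cons S \<tau>)
  have "set (S # \<tau>) \<subseteq> set \<sigma> \<inter> Collect nontrivial"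
    unfolding Cons[symmetric] by auto
  then have S: "connected_set graph_G S" "nontrivial S" and \<tau>: "\<tau> \<in> strategies graph_G"
    using \<sigma> by (auto simp: strategies_def)
  have gt': "strategy_op \<tau> (averaging S omega) $ Vx > 2"
    using gt strategy_op_filter_nontrivial[OF \<sigma>, of omega] Cons by simp
  then have "\<not> bounded_by 2 (averaging S omega)"
    using strategy_value_le[OF \<tau>, of 2] by force
  then consider "S = {Vx, Vc}" | "S = {Vx, Vd}"
    using bounded_by_first[OF S] by blast
  then obtain p q where pq: "p = Vc \<and> q = Vd \<or> p = Vd \<and> q = Vc" and p: "S = {Vx, p}"
    by metis
  have "{Vx, p} \<in> set \<tau>"
    using strategy_value_le_avoiding[OF \<tau> _ bounded_avoiding_first[OF pq] pq] gt' p by force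
  with that pq p Cons show ?thesis
    by blast
qed

lemma count_list_filter_le: "count_list (filter P xs) x \<le> count_list xs x"
  by (induction xs) auto

lemma value_gt_2_repeats:
  assumes \<sigma>: "\<sigma> \<in> strategies graph_G" and gt: "strategy_op \<sigma> omega $ Vx > 2"
  shows "\<exists>S. connected_set graph_G S \<and> nontrivial S \<and> count_list \<sigma> S \<ge> 2"
proof -
  obtain p \<tau> where \<tau>: "filter nontrivial \<sigma> = {Vx, p} # \<tau>" "{Vx, p} \<in> set \<tau>"
    using value_gt_2_returns[OF assms] by metis
  have "{Vx, p} \<in> set (filter nontrivial \<sigma>)"
    by (simp add: \<tau>(1))
  then have "connected_set graph_G {Vx, p}" "nontrivial {Vx, p}"
    using \<sigma> by (auto simp: strategies_def)
  moreover have "count_list \<tau> {Vx, p} \<noteq> 0"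
    using \<tau>(2) by (simp add: count_list_0_iff)
  then have "count_list \<sigma> {Vx, p} \<ge> 2"
    using count_list_filter_le[of nontrivial \<sigma> "{Vx, p}"] by (simp add: \<tau>(1))
  ultimately show ?thesis
    by blast
qed

text \<open>The sum \<open>y $ Vx + y $ p\<close> is twice the weight of the target after one more averaging over
  \<open>{Vx, p}\<close>.\<close>

lemma averaging_twice_le:
  assumes "connected_set graph_G T" "nontrivial T" "p = Vc \<or> p = Vd"
  defines "y \<equiv> averaging T (averaging {Vx, p} omega)"
  shows "y $ Vx \<le> 2" "y $ Vx + y $ p \<le> 4"
  using assms(3) connected_nontrivial_cases[OF assms(1,2)]
  unfolding insert_iff empty_iff y_def
  by (elim disjE; simp add: averaging_in averaging_notin)+

lemma value_gt_2_length:
  assumes \<sigma>: "\<sigma> \<in> strategies graph_G" and gt: "strategy_op \<sigma> omega $ Vx > 2"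
  shows "length \<sigma> \<ge> 4"
proof (rule ccontr)
  assume short: "\<not> length \<sigma> \<ge> 4"
  obtain p \<tau> where p: "p = Vc \<or> p = Vd" and eq: "filter nontrivial \<sigma> = {Vx, p} # \<tau>"
    and mem: "{Vx, p} \<in> set \<tau>"
    using value_gt_2_returns[OF assms] .
  define y where "y = averaging {Vx, p} omega"
  have y: "y $ Vx = 1 / 2" "y $ p = 1 / 2"
    using p by (auto simp: y_def averaging_in)
  have gt': "strategy_op \<tau> y $ Vx > 2"
    using gt strategy_op_filter_nontrivial[OF \<sigma>, of omega] by (simp add: eq y_def)
  have T: "connected_set graph_G T \<and> nontrivial T" if "T \<in> set \<tau>" for T
  proof -
    have "T \<in> set (filter nontrivial \<sigma>)"
      using that by (simp add: eq)
    then show ?thesis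
      using \<sigma> by (auto simp: strategies_def)
  qed
  have "length \<tau> \<le> 2"
    using short length_filter_le[of nontrivial \<sigma>] by (simp add: eq)
  then consider "\<tau> = [{Vx, p}]" | T where "\<tau> = [{Vx, p}, T]" | T where "\<tau> = [T, {Vx, p}]"
    using mem by (cases \<tau>; cases "tl \<tau>"; auto)
  then show False
  proof cases
    case 1
    then show ?thesis
      using gt' y p by (auto simp: averaging_in)
  next
    case (2 T)
    have "averaging {Vx, p} y = y"
      using y p by (auto simp: vec_eq_iff averaging_def)
    then show ?thesis
      using 2 gt' averaging_twice_le(1)[of T p] T[of T] p by (auto simp: y_def)
  next
    case (3 T)
    have "averaging {Vx, p} (averaging T y) $ Vx = (averaging T y $ Vx + averaging T y $ p) / 2"
      using p by (auto simp: averaging_in)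
    then show ?thesis
      using 3 gt' averaging_twice_le(2)[of T p] T[of T] p by (auto simp: y_def)
  qed
qed

text \<open>A shortest optimal strategy.  Its weights run from \<open>(2, 5, 1, 0, 0)\<close> through
  \<open>(2, 5, 1/2, 1/2, 0)\<close>, \<open>(2, 11/4, 1/2, 11/4, 0)\<close> and \<open>(21/16, 21/16, 21/16, 11/4, 21/16)\<close>
  to \<open>65/32\<close> at both \<open>x\<close> and \<open>c\<close>.\<close>

definition witness :: "vertex set list" where
  "witness = [{Vx, Vc}, {Vb, Vc}, {Va, Vb, Vx, Vd}, {Vx, Vc}]"

lemma witness_strategy: "witness \<in> strategies graph_G"
  by (simp add: witness_def strategies_def connected_sets)

lemma witness_value: "strategy_op witness omega $ Vx = 65 / 32"
  by (simp add: witness_def averaging_in averaging_notin)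

lemma maximum_value: "is_maximum (65 / 32) ((\<lambda>\<sigma>. strategy_op \<sigma> omega $ Vx) ` strategies graph_G)"
  unfolding is_maximum_def
  using witness_strategy witness_value strategy_value_le[OF _ bounded_by_omega]
  by (auto intro!: image_eqI[of _ _ witness])

lemma is_maximum_unique: "is_maximum m A \<Longrightarrow> is_maximum n A \<Longrightarrow> m = n"
  unfolding is_maximum_def by (blast intro: order.antisym)

lemma optimal_strategies_eq:
  "optimal_strategies graph_G Vx omega =
    {\<sigma> \<in> strategies graph_G. strategy_op \<sigma> omega $ Vx = 65 / 32}"
proof -
  have "is_maximum m ((\<lambda>\<tau>. strategy_op \<tau> omega $ Vx) ` strategies graph_G) \<longleftrightarrow> m = 65 / 32" for m
    using maximum_value is_maximum_unique by blast
  then show ?thesis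
    by (simp add: optimal_strategies_def)
qed

theorem theorem1p3:
  shows "is_maximum (65 / 32) ((\<lambda>\<sigma>. strategy_op \<sigma> omega $ Vx) ` strategies graph_G)
    \<and> is_maximum 2
        ((\<lambda>\<sigma>. strategy_op \<sigma> omega $ Vx) ` {\<sigma> \<in> strategies graph_G. repetition_free graph_G \<sigma>})
    \<and> (\<forall>\<sigma> \<in> optimal_strategies graph_G Vx omega.
         \<exists>S. connected_set graph_G S \<and> nontrivial S \<and> count_list \<sigma> S \<ge> 2)
    \<and> is_minimum 4 (length ` optimal_strategies graph_G Vx omega)"
proof (intro conjI ballI)
  show "is_maximum (65 / 32) ((\<lambda>\<sigma>. strategy_op \<sigma> omega $ Vx) ` strategies graph_G)"
    by (rule maximum_value)
  show "is_maximum 2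
    ((\<lambda>\<sigma>. strategy_op \<sigma> omega $ Vx) ` {\<sigma> \<in> strategies graph_G. repetition_free graph_G \<sigma>})"
    unfolding is_maximum_def
  proof (intro conjI ballI)
    have "[{Vb, Vx, Vc}] \<in> strategies graph_G" "repetition_free graph_G [{Vb, Vx, Vc}]"
      "strategy_op [{Vb, Vx, Vc}] omega $ Vx = 2"
      by (simp_all add: strategies_def connected_sets repetition_free_def averaging_in)
    then show "2 \<in> (\<lambda>\<sigma>. strategy_op \<sigma> omega $ Vx) `
        {\<sigma> \<in> strategies graph_G. repetition_free graph_G \<sigma>}"
      by (intro image_eqI[of _ _ "[{Vb, Vx, Vc}]"]) auto
  next
    fix y
    assume "y \<in> (\<lambda>\<sigma>. strategy_op \<sigma> omega $ Vx) `
        {\<sigma> \<in> strategies graph_G. repetition_free graph_G \<sigma>}"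
    then show "y \<le> 2"
      using value_gt_2_repeats by (fastforce simp: repetition_free_def not_le[symmetric])
  qed
  show "\<exists>S. connected_set graph_G S \<and> nontrivial S \<and> count_list \<sigma> S \<ge> 2"
    if "\<sigma> \<in> optimal_strategies graph_G Vx omega" for \<sigma>
    using that value_gt_2_repeats[of \<sigma>] by (simp add: optimal_strategies_eq)
  show "is_minimum 4 (length ` optimal_strategies graph_G Vx omega)"
    unfolding is_minimum_def
  proof (intro conjI ballI)
    have "witness \<in> optimal_strategies graph_G Vx omega" "length witness = 4"
      using witness_strategy witness_value by (simp_all add: optimal_strategies_eq witness_def)
    then show "4 \<in> length ` optimal_strategies graph_G Vx omega"
      by (metis image_eqI)
  next
    fix n
    assume "n \<in> length ` optimal_strategies graph_G Vx omega"
    then show "4 \<le> n"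
      using value_gt_2_length by (auto simp: optimal_strategies_eq)
  qed
qed

end
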